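(* Let $p\ge 3$ be an odd integer and let $q$ be the smallest positive integer with $2^q\equiv 1\pmod p$. Then the $p$-colorable subgroup $\mathcal{F}_p$ of Thompson's group $F$ is isomorphic to the Brown--Thompson group $F(2^q)$; an isomorphism $F(2^q)\to\mathcal{F}_p$ is given by the map $\phi_q$.
   Context: **Brown--Thompson groups.** Let $n\ge 2$. An $n$-ary tree is a finite rooted ordered tree in which each vertex has either $0$ children (a leaf) or exactly $n$ children; an $n$-caret is the $n$-ary tree with exactly one internal vertex. Edges from a vertex to its children are labeled $0,\dots,n-1$ from left to right, and each leaf is identified with the word on $\{0,\dots,n-1\}$ read along the path from the root. Leaves are numbered $0,1,2,\dots$ from left to right. Consider pairs $(T_+,T_-)$ of $n$-ary trees with the same number of leaves; $i_+$, $i_-$ denote the $i$-th leaves of $T_+$, $T_-$. An insertion attaches an $n$-caret to leaf $i_+$ of $T_+$ and to leaf $i_-$ of $T_-$ (same $i$); a reduction is the inverse. $F(n)$ is the set of such pairs modulo the equivalence relation generated by insertions and reductions, with product $[(A_+,A_-)][(A_-,B_-)]=[(A_+,B_-)]$ (representatives with matching middle tree can always be found by insertions), identity the class of $(T,T)$, and inverse $[(T_+,T_-)]^{-1}=[(T_-,T_+)]$. Thompson's group is $F=F(2)$. **The subgroup $\mathcal{F}_p$.** For a binary word put $\rho(a_1\cdots a_m)=\sum_{i=1}^m a_i/2^i\in\mathbb{Z}[1/2]$; since $p$ is odd, elements of $\mathbb{Z}[1/2]$ can be reduced modulo $p$. Define $\mathcal{F}_p=\{(T_+,T_-)\in F\mid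 \rho(i_+)\equiv\rho(i_-)\pmod p\text{ for all } i\ge 0\}$ (the condition does not depend on the chosen representative). **The map $\phi_q$.** $T_q$ is the complete binary tree of depth $q$, whose leaves are all $2^q$ binary words of length $q$. The map $\phi_q:F(2^q)\to F$ sends the class of a pair of $2^q$-ary trees to the class of the pair of binary trees obtained by replacing every $2^q$-caret by a copy of $T_q$ (matching the leaves in left-to-right order). *)

theory Defs
  imports Complex_Main "HOL-Algebra.Group" "HOL-Number_Theory.Cong"
begin

section \<open>Finite ordered trees\<close>

datatype tree = Leaf | Node "tree list"

fun nary :: "nat \<Rightarrow> tree \<Rightarrow> bool" where
  "nary n Leaf \<longleftrightarrow> True"
| "nary n (Node ts) \<longleftrightarrow> length ts = n \<and> (\<forall>t\<in>set ts. nary n t)"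

text \<open>The leaves from left to right, each given as the word of edge labels along the path from
  the root; the \<open>i\<close>-th leaf of \<open>t\<close> is \<open>leaves t ! i\<close>.\<close>

primrec leaves :: "tree \<Rightarrow> nat list list" where
  "leaves Leaf = [[]]"
| "leaves (Node ts) =
     concat (map (\<lambda>(a, ws). map ((#) a) ws) (enumerate 0 (map leaves ts)))"

abbreviation num_leaves :: "tree \<Rightarrow> nat" where
  "num_leaves t \<equiv> length (leaves t)"

text \<open>\<open>plug t ss\<close> replaces the \<open>i\<close>-th leaf of \<open>t\<close> by the tree \<open>ss ! i\<close>; it is only meaningful for
  \<open>length ss = num_leaves t\<close>.\<close>

fun plug :: "tree \<Rightarrow> tree list \<Rightarrow> tree"
  and plug_forest :: "tree list \<Rightarrow> tree list \<Rightarrow> tree list" where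
  "plug Leaf ss = hd ss"
| "plug (Node ts) ss = Node (plug_forest ts ss)"
| "plug_forest [] ss = []"
| "plug_forest (t # ts) ss =
     plug t (take (num_leaves t) ss) # plug_forest ts (drop (num_leaves t) ss)"

definition caret :: "nat \<Rightarrow> tree" where
  "caret n = Node (replicate n Leaf)"

definition attach_caret :: "nat \<Rightarrow> nat \<Rightarrow> tree \<Rightarrow> tree" where
  "attach_caret n i t = plug t ((replicate (num_leaves t) Leaf)[i := caret n])"


section \<open>The Brown--Thompson groups\<close>

definition tree_pairs :: "nat \<Rightarrow> (tree \<times> tree) set" where
  "tree_pairs n = {(A, B). nary n A \<and> nary n B \<and> num_leaves A = num_leaves B}"

definition insertion :: "nat \<Rightarrow> ((tree \<times> tree) \<times> (tree \<times> tree)) set" where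
  "insertion n = {((A, B), (attach_caret n i A, attach_caret n i B)) | A B i.
     (A, B) \<in> tree_pairs n \<and> i < num_leaves A}"

text \<open>The equivalence relation on \<open>tree_pairs n\<close> generated by insertions and their inverses,
  the reductions.\<close>

definition pair_equiv :: "nat \<Rightarrow> ((tree \<times> tree) \<times> (tree \<times> tree)) set" where
  "pair_equiv n = Restr ((insertion n \<union> (insertion n)\<inverse>)\<^sup>*) (tree_pairs n)"

definition pair_class :: "nat \<Rightarrow> tree \<times> tree \<Rightarrow> (tree \<times> tree) set" where
  "pair_class n x = pair_equiv n `` {x}"

text \<open>The product of two classes is written as the union, over all representatives with matching
  middle tree, of the resulting classes. For \<open>n \<ge> 2\<close> these all coincide, so that the union is the
  single class of the product.\<close>

definition brown_thompson :: "nat \<Rightarrow> (tree \<times> tree) set monoid" where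
  "brown_thompson n =
     \<lparr>carrier = tree_pairs n // pair_equiv n,
      monoid.mult = (\<lambda>X Y. \<Union> {pair_class n (A, C) | A B C. (A, B) \<in> X \<and> (B, C) \<in> Y}),
      one = pair_class n (Leaf, Leaf)\<rparr>"

abbreviation thompson_F :: "(tree \<times> tree) set monoid" where
  "thompson_F \<equiv> brown_thompson 2"


section \<open>The \<open>p\<close>-colorable subgroup\<close>

definition rho :: "nat list \<Rightarrow> rat" where
  "rho w = (\<Sum>i<length w. of_nat (w ! i) / 2 ^ Suc i)"

definition dyadic :: "rat set" where
  "dyadic = {of_int a / 2 ^ k | a k. True}"

text \<open>Congruence modulo the ideal generated by \<open>p\<close> in the ring \<open>dyadic\<close>, that is, \<open>\<int>[1/2]\<close>.\<close>

definition dyadic_cong :: "nat \<Rightarrow> rat \<Rightarrow> rat \<Rightarrow> bool" where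
  "dyadic_cong p x y \<longleftrightarrow> (\<exists>c\<in>dyadic. x - y = of_nat p * c)"

definition colorable_pair :: "nat \<Rightarrow> tree \<times> tree \<Rightarrow> bool" where
  "colorable_pair p = (\<lambda>(A, B).
     \<forall>i<num_leaves A. dyadic_cong p (rho (leaves A ! i)) (rho (leaves B ! i)))"

definition colorable_subgroup :: "nat \<Rightarrow> (tree \<times> tree) set set" where
  "colorable_subgroup p = {pair_class 2 x | x. x \<in> tree_pairs 2 \<and> colorable_pair p x}"


section \<open>The caret replacement map\<close>

primrec complete_tree :: "nat \<Rightarrow> tree" where
  "complete_tree 0 = Leaf"
| "complete_tree (Suc q) = Node [complete_tree q, complete_tree q]"

primrec binarize :: "nat \<Rightarrow> tree \<Rightarrow> tree" where
  "binarize q Leaf = Leaf"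
| "binarize q (Node ts) = plug (complete_tree q) (map (binarize q) ts)"

text \<open>As for the product, the union is over representatives of one class and all the classes in it
  coincide.\<close>

definition phi :: "nat \<Rightarrow> (tree \<times> tree) set \<Rightarrow> (tree \<times> tree) set" where
  "phi q X = (\<Union>(A, B)\<in>X. pair_class 2 (binarize q A, binarize q B))"

end

theory Submission
  imports Defs "HOL-Number_Theory.Pocklington"
begin

text \<open>Call \<open>(A', B')\<close> an expansion of \<open>(A, B)\<close> if the same forest, grafted onto both trees, yields it.
  Everything about the groups \<open>F(n)\<close> follows from a few facts about this preorder. An expansion of
  \<open>(A, B)\<close> is determined by its first tree, inverses and products of pairs respect expansion, and every pair
  expands to one whose first tree is the full \<open>n\<close>-ary tree of any sufficiently large depth. Hence two
  expansions of one pair have a common expansion, the equivalence generated by insertions is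
  "having a common expansion" (\<open>pair_equiv_iff\<close>), and any two classes have representatives
  with matching middle tree, which gives the group (\<open>group_brown_thompson\<close>).

  Grafting commutes with replacing carets, so \<open>\<phi>\<^sub>q\<close> respects expansions and is a homomorphism. Its
  kernel is trivial: a pair of class \<open>1\<close> expands to a pair with two equal trees, and since grafting
  can be cancelled on both sides, its own trees are then equal; and \<open>binarize q\<close> is injective.
  Both cancellation of a common graft and injectivity are read off from the list of leaf depths, which
  determines a tree of given arity (\<open>depths_inject\<close>).

  For the image, think of the leaves of a binary tree as the standard dyadic intervals that partition
  \<open>[0, 1)\<close>: \<open>\<rho>\<close> of a leaf is the left endpoint, the width is \<open>1 / 2^d\<close> at depth \<open>d\<close>, and so the
  \<open>i\<close>-th endpoint is the sum of the widths before it. Congruence of all endpoints is therefore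
  congruence of all widths, and as \<open>q\<close> is the order of \<open>2\<close> modulo \<open>p\<close>, a pair is colorable iff the
  depths of corresponding leaves agree modulo \<open>q\<close> (\<open>colorable_pair_iff\<close>). The leaf depths of
  \<open>binarize q A\<close> are multiples of \<open>q\<close>, so the image of \<open>\<phi>\<^sub>q\<close> is colorable. Conversely, expand a
  colorable pair until its first tree is complete of depth divisible by \<open>q\<close>. The depths in the
  second tree are then multiples of \<open>q\<close> too, and such trees are exactly the values of \<open>binarize q\<close>
  (\<open>binarize_surj\<close>).\<close>

section \<open>Leaf counts and leaf depths\<close>

definition depths :: "tree \<Rightarrow> nat list" where
  "depths t = map length (leaves t)"

lemma length_depths [simp]: "length (depths t) = num_leaves t"
  by (simp add: depths_def)

lemma depths_Leaf [simp]: "depths Leaf = [0]"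
  by (simp add: depths_def)

lemma depths_Node [simp]: "depths (Node ts) = map Suc (concat (map depths ts))"
proof -
  have "map length (concat (map (\<lambda>(a, ws). map ((#) a) ws) (List.enumerate k wss)))
      = map Suc (concat (map (map length) wss))" for k and wss :: "nat list list list"
    by (induction wss arbitrary: k) auto
  then show ?thesis
    by (simp add: comp_def depths_def[abs_def])
qed

declare leaves.simps(2) [simp del]

lemma num_leaves_Node [simp]: "num_leaves (Node ts) = sum_list (map num_leaves ts)"
  using arg_cong[OF depths_Node[of ts], of length]
  by (simp add: length_concat comp_def del: depths_Node)

lemma num_leaves_pos: "0 < n \<Longrightarrow> nary n t \<Longrightarrow> 0 < num_leaves t"
proof (induction t)
  case (Node ts)
  then have "ts \<noteq> []" by auto
  with Node show ?case by (cases ts) auto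
qed simp


section \<open>The algebra of grafting\<close>

lemma length_plug_forest [simp]: "length (plug_forest ts ss) = length ts"
  by (induction ts arbitrary: ss) auto

lemma num_leaves_plug:
  "length ss = num_leaves t \<Longrightarrow> num_leaves (plug t ss) = sum_list (map num_leaves ss)"
  and num_leaves_plug_forest:
  "length ss = sum_list (map num_leaves ts) \<Longrightarrow>
    sum_list (map num_leaves (plug_forest ts ss)) = sum_list (map num_leaves ss)"
proof (induction t ss and ts ss rule: plug_plug_forest.induct)
  case (1 ss)
  then show ?case by (cases ss) auto
next
  case (4 t ts ss)
  have "sum_list (map num_leaves ss) =
    sum_list (map num_leaves (take (num_leaves t) ss @ drop (num_leaves t) ss))" by simp
  then show ?case using 4 unfolding map_append sum_list_append by simp
qed simp_all

lemma nary_plug: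
  "nary n t \<Longrightarrow> length ss = num_leaves t \<Longrightarrow> \<forall>s\<in>set ss. nary n s \<Longrightarrow> nary n (plug t ss)"
  and nary_plug_forest:
  "\<forall>t\<in>set ts. nary n t \<Longrightarrow> length ss = sum_list (map num_leaves ts) \<Longrightarrow> \<forall>s\<in>set ss. nary n s \<Longrightarrow>
    \<forall>t\<in>set (plug_forest ts ss). nary n t"
proof (induction t ss and ts ss rule: plug_plug_forest.induct)
  case (1 ss)
  then show ?case by (cases ss) auto
next
  case (2 ts ss)
  then have "length ts = n" "\<forall>t\<in>set ts. nary n t" "length ss = sum_list (map num_leaves ts)"
    by simp_all
  from this(1) 2(1)[OF this(2,3) 2(4)] show ?case by simp
next
  case (4 t ts ss)
  let ?ss\<^sub>1 = "take (num_leaves t) ss" and ?ss\<^sub>2 = "drop (num_leaves t) ss"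
  have sub: "\<forall>s\<in>set ?ss\<^sub>1. nary n s" "\<forall>s\<in>set ?ss\<^sub>2. nary n s"
    using 4(5) set_take_subset[of _ ss] set_drop_subset[of _ ss] by blast+
  have "nary n (plug t ?ss\<^sub>1)"
    by (rule 4(1)[OF _ _ sub(1)]) (use 4(3,4) in auto)
  moreover have "\<forall>t\<in>set (plug_forest ts ?ss\<^sub>2). nary n t"
    by (rule 4(2)[OF _ _ sub(2)]) (use 4(3,4) in auto)
  ultimately show ?case unfolding plug_forest.simps by (metis set_ConsD)
qed simp_all

lemma plug_Leaves [simp]: "plug t (replicate (num_leaves t) Leaf) = t"
proof (induction t)
  case (Node ts)
  then have "plug_forest ts (replicate (sum_list (map num_leaves ts)) Leaf) = ts"
    by (induction ts) auto
  then show ?case by simp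
qed simp

lemma plug_forest_append:
  "length ss = sum_list (map num_leaves ts) \<Longrightarrow>
    plug_forest (ts @ us) (ss @ vs) = plug_forest ts ss @ plug_forest us vs"
  by (induction ts arbitrary: ss) auto

lemma take_plug_forest:
  "take k (plug_forest ts ss) =
    plug_forest (take k ts) (take (sum_list (map num_leaves (take k ts))) ss)"
proof (induction ts arbitrary: ss k)
  case (Cons t ts)
  then show ?case by (cases k) (simp_all add: drop_take)
qed simp

lemma drop_plug_forest:
  "drop k (plug_forest ts ss) =
    plug_forest (drop k ts) (drop (sum_list (map num_leaves (take k ts))) ss)"
proof (induction ts arbitrary: ss k)
  case (Cons t ts)
  then show ?case by (cases k) (simp_all add: add.commute)
qed simp

text \<open>Grafting is associative; the grafts of the two steps combine by grafting forests.\<close>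

lemma plug_plug:
  "length ss = num_leaves t \<Longrightarrow> length us = sum_list (map num_leaves ss) \<Longrightarrow>
    plug (plug t ss) us = plug t (plug_forest ss us)"
  and plug_forest_plug_forest:
  "length ss = sum_list (map num_leaves ts) \<Longrightarrow> length us = sum_list (map num_leaves ss) \<Longrightarrow>
    plug_forest (plug_forest ts ss) us = plug_forest ts (plug_forest ss us)"
proof (induction t ss and ts ss arbitrary: us and us rule: plug_plug_forest.induct)
  case (1 ss)
  then show ?case by (cases ss) auto
next
  case (4 t ts ss)
  let ?k = "num_leaves t"
  have "sum_list (map num_leaves ss) =
    sum_list (map num_leaves (take ?k ss)) + sum_list (map num_leaves (drop ?k ss))"
    by (metis append_take_drop_id map_append sum_list_append)
  then show ?case using 4
    by (simp add: num_leaves_plug take_plug_forest drop_plug_forest)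
qed simp_all

lemma plug_left_cancel:
  "plug t ss = plug t rs \<Longrightarrow> length ss = num_leaves t \<Longrightarrow> length rs = num_leaves t \<Longrightarrow> ss = rs"
  and plug_forest_left_cancel:
  "plug_forest ts ss = plug_forest ts rs \<Longrightarrow> length ss = sum_list (map num_leaves ts) \<Longrightarrow>
    length rs = sum_list (map num_leaves ts) \<Longrightarrow> ss = rs"
proof (induction t ss and ts ss arbitrary: rs and rs rule: plug_plug_forest.induct)
  case (1 ss)
  then show ?case by (cases ss; cases rs) auto
next
  case (4 t ts ss)
  then have "take (num_leaves t) ss = take (num_leaves t) rs"
    "drop (num_leaves t) ss = drop (num_leaves t) rs" by simp_all
  then show ?case by (metis append_take_drop_id)
qed simp_all

lemma depths_plug:
  "length ss = num_leaves t \<Longrightarrow>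
    depths (plug t ss) = concat (map2 (\<lambda>d s. map ((+) d) (depths s)) (depths t) ss)"
  and depths_plug_forest:
  "length ss = sum_list (map num_leaves ts) \<Longrightarrow>
    concat (map depths (plug_forest ts ss)) =
      concat (map2 (\<lambda>d s. map ((+) d) (depths s)) (concat (map depths ts)) ss)"
proof (induction t ss and ts ss rule: plug_plug_forest.induct)
  case (1 ss)
  then show ?case by (cases ss) (auto intro: map_idI[symmetric])
next
  case (2 ts ss)
  have "map Suc (concat (map2 (\<lambda>d s. map ((+) d) (depths s)) ds ss)) =
    concat (map2 (\<lambda>d s. map ((+) d) (depths s)) (map Suc ds) ss)" for ds
    by (simp add: map_concat zip_map1 comp_def split_def plus_nat.add_Suc[abs_def])
  with 2 show ?case by simp
next
  case (4 t ts ss)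
  have "zip (depths t @ concat (map depths ts)) ss =
     zip (depths t) (take (num_leaves t) ss) @ zip (concat (map depths ts)) (drop (num_leaves t) ss)"
    by (simp add: zip_append1)
  with 4 show ?case by simp
qed simp_all

text \<open>An \<open>n\<close>-ary tree can be parsed from its leaf depths: reading from the left, one sees where each
  subtree ends. The offset \<open>k\<close> and the remainders \<open>xs\<close> and \<open>ys\<close> let the induction treat a subtree
  as the initial segment of a longer list.\<close>

lemma depths_prefix_code:
  assumes "0 < n"
  shows "nary n A \<Longrightarrow> nary n B \<Longrightarrow>
    map ((+) k) (depths A) @ xs = map ((+) k) (depths B) @ ys \<Longrightarrow> A = B \<and> xs = ys"
proof (induction A arbitrary: B k xs ys)
  case Leaf
  show ?case
  proof (cases B)
    case (Node us)
    then have "depths B \<noteq> []" 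
      using num_leaves_pos[OF assms Leaf.prems(2)] by (metis length_depths length_greater_0_conv)
    then obtain d ds where ds: "depths B = d # ds" by (cases "depths B") auto
    then have "0 \<noteq> d" using Node by auto
    then show ?thesis using Leaf ds by simp
  qed (use Leaf in simp)
next
  case (Node ts)
  show ?case
  proof (cases B)
    case Leaf
    have "depths (Node ts) \<noteq> []" 
      using num_leaves_pos[OF assms Node.prems(1)] by (metis length_depths length_greater_0_conv)
    then obtain d ds where ds: "depths (Node ts) = d # ds" by (cases "depths (Node ts)") auto
    then have "0 \<noteq> d" by auto
    then show ?thesis using Node.prems(3) unfolding Leaf ds by simp
  next
    case B: (Node us)
    have forest: "ts = us \<and> xs = ys"
      if "length ts = length us" "\<forall>u\<in>set us. nary n u" "\<forall>t\<in>set ts. nary n t"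
        "map ((+) (Suc k)) (concat (map depths ts)) @ xs = map ((+) (Suc k)) (concat (map depths us)) @ ys"
        "\<And>t B k xs ys. t \<in> set ts \<Longrightarrow> nary n t \<Longrightarrow> nary n B \<Longrightarrow>
          map ((+) k) (depths t) @ xs = map ((+) k) (depths B) @ ys \<Longrightarrow> t = B \<and> xs = ys"
      for ts us
      using that
    proof (induction ts us rule: list_induct2)
      case (Cons t ts u us)
      have head: "t = u \<and> map ((+) (Suc k)) (concat (map depths ts)) @ xs
          = map ((+) (Suc k)) (concat (map depths us)) @ ys"
      proof (rule Cons.prems(4)[where k = "Suc k"])
        show "nary n t" "nary n u" using Cons.prems(1,2) by simp_all
        show "map ((+) (Suc k)) (depths t) @ map ((+) (Suc k)) (concat (map depths ts)) @ xs =
          map ((+) (Suc k)) (depths u) @ map ((+) (Suc k)) (concat (map depths us)) @ ys"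
          using Cons.prems(3) by (simp del: plus_nat.add_Suc)
      qed simp
      have "ts = us \<and> xs = ys"
      proof (rule Cons.IH)
        show "\<forall>u\<in>set us. nary n u" "\<forall>t\<in>set ts. nary n t" using Cons.prems(1,2) by simp_all
        show "t = B \<and> xs = ys"
          if "t \<in> set ts" "nary n t" "nary n B" "map ((+) k) (depths t) @ xs = map ((+) k) (depths B) @ ys"
          for t B k xs ys
          by (rule Cons.prems(4)[OF _ that(2-4)]) (use that(1) in simp)
      qed (rule conjunct2[OF head])
      with conjunct1[OF head] show ?case by simp
    qed simp
    have "ts = us \<and> xs = ys"
    proof (rule forest)
      show "length ts = length us" "\<forall>u\<in>set us. nary n u" "\<forall>t\<in>set ts. nary n t"
        using Node.prems(1,2) unfolding B by simp_all
      show "map ((+) (Suc k)) (concat (map depths ts)) @ xs =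
          map ((+) (Suc k)) (concat (map depths us)) @ ys"
        using Node.prems(3) unfolding B by (simp add: comp_def plus_nat.add_Suc[abs_def])
    qed (rule Node.IH)
    then show ?thesis unfolding B by simp
  qed
qed

lemma depths_inject:
  assumes "0 < n" "nary n A" "nary n B" "depths A = depths B"
  shows "A = B"
  using depths_prefix_code[OF assms(1-3), of 0 "[]" "[]"] assms(4) by simp

text \<open>Each of the two depth lists of the grafted trees is a concatenation of blocks, one for
  each graft. The block of \<open>s\<close> has length \<open>num_leaves s\<close> on both sides, so blocks match up, and
  a block, being nonempty, reveals the depth of the leaf that carries it.\<close>

lemma plug_right_cancel:
  assumes "0 < n" "nary n A" "nary n B" "num_leaves A = num_leaves B"
    and "length ss = num_leaves A" "\<forall>s\<in>set ss. nary n s" "plug A ss = plug B ss"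
  shows "A = B"
proof -
  let ?f = "\<lambda>d s. map ((+) d) (depths s)"
  have "ds = es" if "length ds = length es" "length es = length ss" "\<forall>s\<in>set ss. depths s \<noteq> []"
    "concat (map2 ?f ds ss) = concat (map2 ?f es ss)" for ds es
    using that
  proof (induction ds es ss rule: list_induct3)
    case (Cons d ds e es s ss)
    then have "?f d s = ?f e s" "concat (map2 ?f ds ss) = concat (map2 ?f es ss)" by auto
    with Cons show ?case by (cases "depths s") auto
  qed simp
  moreover have "\<forall>s\<in>set ss. depths s \<noteq> []"
    using assms(6) num_leaves_pos[OF assms(1)] by (metis length_depths length_greater_0_conv)
  ultimately have "depths A = depths B"
    using assms(4,5,7) depths_plug[of ss A] depths_plug[of ss B] by simp
  then show ?thesis by (rule depths_inject[OF assms(1-3)])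
qed


section \<open>Cofinality of the full trees\<close>

text \<open>The forests that can be grafted onto \<open>t\<close> without leaving the \<open>n\<close>-ary trees. Membership depends on
  \<open>t\<close> only through the number of leaves, so both trees of a pair have the same grafts.\<close>

definition grafts :: "nat \<Rightarrow> tree \<Rightarrow> tree list set" where
  "grafts n t = {ss. length ss = num_leaves t \<and> (\<forall>s\<in>set ss. nary n s)}"

lemma graft_nary: "ss \<in> grafts n t \<Longrightarrow> s \<in> set ss \<Longrightarrow> nary n s"
  by (simp add: grafts_def)

primrec full :: "nat \<Rightarrow> nat \<Rightarrow> tree" where
  "full n 0 = Leaf"
| "full n (Suc k) = Node (replicate n (full n k))"

lemma nary_full [simp]: "nary n (full n k)"
  by (induction k) simp_all

lemma plug_forest_concat:
  "\<forall>t\<in>set ts. length (f t) = num_leaves t \<Longrightarrow>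
    plug_forest ts (concat (map f ts)) = map (\<lambda>t. plug t (f t)) ts"
  by (induction ts) simp_all

text \<open>All large depths are reached, not just one, so that several trees, in particular
  the children of a node, can be completed to a common depth.\<close>

lemma ex_graft_full:
  "nary n t \<Longrightarrow> \<exists>K. \<forall>k\<ge>K. \<exists>ss\<in>grafts n t. plug t ss = full n k"
proof (induction t)
  case Leaf
  have "[full n k] \<in> grafts n Leaf \<and> plug Leaf [full n k] = full n k" for k
    by (simp add: grafts_def)
  then show ?case by blast
next
  case (Node ts)
  then have "\<forall>t\<in>set ts. \<exists>K. \<forall>k\<ge>K. \<exists>ss\<in>grafts n t. plug t ss = full n k" by simp
  then obtain K where K: "\<And>t k. t \<in> set ts \<Longrightarrow> K t \<le> k \<Longrightarrow> \<exists>ss\<in>grafts n t. plug t ss = full n k"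
    by metis
  have "\<exists>ss\<in>grafts n (Node ts). plug (Node ts) ss = full n k" if k: "Suc (Max (K ` set ts)) \<le> k" for k
  proof -
    obtain k' where k': "k = Suc k'" using k by (cases k) auto
    have "\<forall>t\<in>set ts. \<exists>ss\<in>grafts n t. plug t ss = full n k'"
      using K k unfolding k' by (metis List.finite_set Max_ge Suc_le_mono finite_imageI imageI le_trans)
    then obtain f where f: "\<And>t. t \<in> set ts \<Longrightarrow> f t \<in> grafts n t"
      "\<And>t. t \<in> set ts \<Longrightarrow> plug t (f t) = full n k'" by metis
    have len: "\<forall>t\<in>set ts. length (f t) = num_leaves t" using f(1) by (simp add: grafts_def)
    then have "map length (map f ts) = map num_leaves ts" by simp
    then have "length (concat (map f ts)) = num_leaves (Node ts)"
      unfolding length_concat num_leaves_Node by (rule arg_cong)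
    moreover have "\<forall>s\<in>set (concat (map f ts)). nary n s"
      using f(1) graft_nary unfolding set_concat set_map by blast
    ultimately have "concat (map f ts) \<in> grafts n (Node ts)" by (simp add: grafts_def)
    moreover have "map (\<lambda>t. plug t (f t)) ts = replicate n (full n k')"
      using f(2) Node.prems by (intro nth_equalityI) simp_all
    then have "plug (Node ts) (concat (map f ts)) = full n k"
      using len k' by (simp add: plug_forest_concat)
    ultimately show ?thesis by blast
  qed
  then show ?case by blast
qed


section \<open>Expansions of tree pairs\<close>

inductive expands :: "nat \<Rightarrow> tree \<times> tree \<Rightarrow> tree \<times> tree \<Rightarrow> bool" for n where
  expandsI: "(A, B) \<in> tree_pairs n \<Longrightarrow> ss \<in> grafts n A \<Longrightarrow>
    expands n (A, B) (plug A ss, plug B ss)"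

lemma tree_pairs_iff:
  "(A, B) \<in> tree_pairs n \<longleftrightarrow> nary n A \<and> nary n B \<and> num_leaves A = num_leaves B"
  by (simp add: tree_pairs_def)

lemma grafts_cong: "num_leaves A = num_leaves B \<Longrightarrow> grafts n A = grafts n B"
  by (simp add: grafts_def)

lemma nary_plug_graft: "nary n t \<Longrightarrow> ss \<in> grafts n t \<Longrightarrow> nary n (plug t ss)"
  by (simp add: grafts_def nary_plug)

lemma Leaves_graft [simp]: "replicate (num_leaves t) Leaf \<in> grafts n t"
  by (simp add: grafts_def)

lemma expands_source: "expands n x y \<Longrightarrow> x \<in> tree_pairs n"
  by (auto elim: expands.cases)

lemma expands_target: "expands n x y \<Longrightarrow> y \<in> tree_pairs n"
proof (induction rule: expands.induct)
  case (expandsI A B ss)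
  then show ?case
    using grafts_cong[of A B n] num_leaves_plug[of ss A] num_leaves_plug[of ss B] nary_plug_graft
    by (simp add: tree_pairs_iff) (simp add: grafts_def)
qed

lemma expands_refl: "x \<in> tree_pairs n \<Longrightarrow> expands n x x"
proof (cases x)
  case (Pair A B)
  assume x: "x \<in> tree_pairs n"
  then have "plug B (replicate (num_leaves A) Leaf) = B"
    using plug_Leaves[of B] unfolding Pair by (simp add: tree_pairs_iff del: plug_Leaves)
  then show ?thesis using expandsI[OF x[unfolded Pair] Leaves_graft] unfolding Pair by simp
qed

lemma plug_forest_graft:
  assumes "ss \<in> grafts n t" "us \<in> grafts n (plug t ss)"
  shows "plug_forest ss us \<in> grafts n t" "plug (plug t ss) us = plug t (plug_forest ss us)"
proof -
  have "length us = sum_list (map num_leaves ss)"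
    using assms by (simp add: grafts_def num_leaves_plug)
  then show "plug_forest ss us \<in> grafts n t" "plug (plug t ss) us = plug t (plug_forest ss us)"
    using assms nary_plug_forest[of ss n us] plug_plug[of ss t us] by (simp_all add: grafts_def)
qed

lemma expands_trans:
  assumes "expands n x y" "expands n y z"
  shows "expands n x z"
  using assms
proof (induction rule: expands.induct)
  case (expandsI A B ss)
  from expandsI(3) obtain us where us: "us \<in> grafts n (plug A ss)"
    "z = (plug (plug A ss) us, plug (plug B ss) us)"
    by (auto elim: expands.cases)
  have "num_leaves (plug A ss) = num_leaves (plug B ss)" "num_leaves A = num_leaves B"
    using expands_source[OF expandsI(3)] expandsI(1) by (simp_all add: tree_pairs_iff)
  then have B: "us \<in> grafts n (plug B ss)" "ss \<in> grafts n B"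
    using us(1) expandsI(2) grafts_cong by metis+
  show ?case
    unfolding us(2) plug_forest_graft(2)[OF expandsI(2) us(1)] plug_forest_graft(2)[OF B(2,1)]
    by (rule expands.intros[OF expandsI(1) plug_forest_graft(1)[OF expandsI(2) us(1)]])
qed

lemma expands_swap:
  assumes "expands n (A, B) (A', B')"
  shows "expands n (B, A) (B', A')"
proof -
  obtain ss where ss: "ss \<in> grafts n A" "A' = plug A ss" "B' = plug B ss" and "(A, B) \<in> tree_pairs n"
    using assms by (auto elim: expands.cases)
  then have "(B, A) \<in> tree_pairs n" "ss \<in> grafts n B"
    using grafts_cong[of A B] by (simp_all add: tree_pairs_iff)
  then show ?thesis unfolding ss by (rule expandsI)
qed

text \<open>The two expansions graft the same forest onto \<open>B\<close>, because left cancellation applies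
  to \<open>B'\<close>. Hence this forest also expands \<open>(A, C)\<close>.\<close>

lemma expands_compose:
  assumes "expands n (A, B) (A', B')" "expands n (B, C) (B', C')"
  shows "expands n (A, C) (A', C')"
proof -
  obtain ss where ss: "ss \<in> grafts n A" "A' = plug A ss" "B' = plug B ss" and AB: "(A, B) \<in> tree_pairs n"
    using assms(1) by (auto elim: expands.cases)
  obtain rs where rs: "rs \<in> grafts n B" "B' = plug B rs" "C' = plug C rs" and BC: "(B, C) \<in> tree_pairs n"
    using assms(2) by (auto elim: expands.cases)
  have "ss = rs"
    using ss rs AB by (intro plug_left_cancel[of B]) (auto simp: grafts_def tree_pairs_iff)
  moreover have "(A, C) \<in> tree_pairs n" using AB BC by (simp add: tree_pairs_iff)
  ultimately show ?thesis using expandsI[of A C n ss] ss rs by simp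
qed

text \<open>Inverting one expansion and composing it with the other expands the diagonal pair
  \<open>(B, B)\<close>, and expansions of diagonal pairs are diagonal.\<close>

lemma expands_unique:
  assumes "expands n (A, B) (A', P)" "expands n (A, B) (A', Q)"
  shows "P = Q"
proof -
  have "expands n (B, B) (P, Q)" by (rule expands_compose[OF expands_swap[OF assms(1)] assms(2)])
  then show ?thesis by (auto elim: expands.cases)
qed

lemma expands_diagonal:
  assumes "0 < n" "expands n (A, B) (Z, Z)"
  shows "A = B"
proof -
  obtain ss where "ss \<in> grafts n A" "plug A ss = plug B ss" "(A, B) \<in> tree_pairs n"
    using assms(2) by (auto elim: expands.cases)
  then show ?thesis
    using plug_right_cancel[OF assms(1), of A B ss] by (simp add: tree_pairs_iff grafts_def)
qed

lemma expands_to_full: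
  assumes "x \<in> tree_pairs n"
  shows "\<exists>K. \<forall>k\<ge>K. \<exists>B. expands n x (full n k, B)"
proof -
  obtain A B where x: "x = (A, B)" by (cases x)
  then have "nary n A" using assms by (simp add: tree_pairs_iff)
  from ex_graft_full[OF this] obtain K where "\<forall>k\<ge>K. \<exists>ss\<in>grafts n A. plug A ss = full n k" ..
  then show ?thesis using expandsI[of A B n] assms unfolding x by metis
qed

lemma expands_to_common_full:
  assumes "x \<in> tree_pairs n" "y \<in> tree_pairs n"
  obtains k B C where "expands n x (full n k, B)" "expands n y (full n k, C)"
proof -
  obtain K L where "\<forall>k\<ge>K. \<exists>B. expands n x (full n k, B)" "\<forall>k\<ge>L. \<exists>B. expands n y (full n k, B)"
    using expands_to_full assms by meson
  then have "\<exists>B. expands n x (full n (max K L), B)" "\<exists>B. expands n y (full n (max K L), B)"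
    by (simp_all only: max.cobounded1 max.cobounded2)
  then show ?thesis using that by blast
qed

text \<open>Confluence: expand \<open>z\<close> and \<open>w\<close> to the same first tree. Both results expand \<open>y\<close>, so
  their second trees agree as well.\<close>

lemma common_expansion_trans:
  assumes "expands n x z" "expands n y z" "expands n y w" "expands n v w"
  shows "\<exists>u. expands n x u \<and> expands n v u"
proof -
  obtain k P Q where P: "expands n z (full n k, P)" and Q: "expands n w (full n k, Q)"
    using expands_to_common_full[OF expands_target[OF assms(1)] expands_target[OF assms(4)]] .
  have "expands n y (full n k, P)" "expands n y (full n k, Q)"
    using expands_trans[OF assms(2) P] expands_trans[OF assms(3) Q] .
  then have "P = Q" using expands_unique by (cases y) blast
  then show ?thesis using expands_trans[OF assms(1) P] expands_trans[OF assms(4) Q] by blast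
qed


section \<open>Equivalence of tree pairs as common expansion\<close>

lemma insertion_expands:
  assumes "(x, y) \<in> insertion n"
  shows "expands n x y"
proof -
  obtain A B i where AB: "(A, B) \<in> tree_pairs n" "i < num_leaves A"
    and xy: "x = (A, B)" "y = (attach_caret n i A, attach_caret n i B)"
    using assms by (auto simp: insertion_def)
  let ?c = "(replicate (num_leaves A) Leaf)[i := caret n]"
  have "nary n s" if "s \<in> set ?c" for s
  proof -
    have "s = caret n \<or> s = Leaf"
      using that set_update_subset_insert[of "replicate (num_leaves A) Leaf" i "caret n"]
      by (auto split: if_splits)
    then show ?thesis by (auto simp: caret_def)
  qed
  then have "?c \<in> grafts n A" by (simp add: grafts_def)
  then show ?thesis
    using expandsI[OF AB(1)] AB(1) unfolding xy attach_caret_def by (simp add: tree_pairs_iff)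
qed

lemma plug_forest_Leaf_left [simp]: "length xs = k \<Longrightarrow> plug_forest (replicate k Leaf) xs = xs"
proof (induction k arbitrary: xs)
  case (Suc k)
  then show ?case by (cases xs) simp_all
qed simp

lemma num_leaves_caret [simp]: "num_leaves (caret n) = n"
  by (simp add: caret_def sum_list_replicate)

text \<open>One attached caret absorbs the \<open>n\<close> grafts at its leaves into a single graft.\<close>

lemma plug_forest_caret:
  assumes "length us = n" "length xs = i" "length ys = j"
  shows "plug_forest (replicate i Leaf @ caret n # replicate j Leaf) (xs @ us @ ys) = xs @ Node us # ys"
proof -
  have "plug_forest (replicate i Leaf @ caret n # replicate j Leaf) (xs @ us @ ys) =
    xs @ plug_forest (caret n # replicate j Leaf) (us @ ys)"
    using assms by (simp add: plug_forest_append sum_list_replicate)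
  also have "\<dots> = xs @ Node us # ys"
    using assms by (simp add: caret_def sum_list_replicate)
  finally show ?thesis .
qed

text \<open>The carets of the forest can be attached one at a time: attach the root caret of one nontrivial
  graft and graft its subtrees at the new leaves.\<close>

lemma expands_rtrancl_insertion:
  "(A, B) \<in> tree_pairs n \<Longrightarrow> ss \<in> grafts n A \<Longrightarrow>
    ((A, B), (plug A ss, plug B ss)) \<in> (insertion n)\<^sup>*"
proof (induction "sum_list (map size ss)" arbitrary: A B ss rule: less_induct)
  case less
  have len: "length ss = num_leaves A" "length ss = num_leaves B"
    using less.prems by (simp_all add: grafts_def tree_pairs_iff)
  show ?case
  proof (cases "\<exists>i<length ss. ss ! i \<noteq> Leaf")
    case False
    then have "ss = replicate (length ss) Leaf" by (intro nth_equalityI) simp_all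
    then have "plug A ss = A" "plug B ss = B" using len plug_Leaves by metis+
    then show ?thesis by simp
  next
    case True
    then obtain i us where i: "i < length ss" and us: "ss ! i = Node us"
      by (metis tree.exhaust)
    have nary_us: "length us = n" "\<forall>u\<in>set us. nary n u"
      using less.prems(2) i us nth_mem[OF i] by (auto simp: grafts_def)
    define xs ys where "xs = take i ss" and "ys = drop (Suc i) ss"
    have ss: "ss = xs @ Node us # ys" using id_take_nth_drop[OF i] us by (simp add: xs_def ys_def)
    let ?c = "replicate i Leaf @ caret n # replicate (length ys) Leaf"
    have c: "(replicate (length ss) Leaf)[i := caret n] = ?c"
      using i by (simp add: upd_conv_take_nth_drop min_def ys_def)
    have attach: "attach_caret n i A = plug A ?c" "attach_caret n i B = plug B ?c"
      unfolding attach_caret_def using len c by simp_all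
    have "((A, B), (attach_caret n i A, attach_caret n i B)) \<in> insertion n"
      unfolding insertion_def using less.prems(1) i len(1) by auto
    then have step: "((A, B), (plug A ?c, plug B ?c)) \<in> insertion n"
      unfolding attach .
    let ?ss' = "xs @ us @ ys"
    have plug_c: "plug_forest ?c ?ss' = ss"
      unfolding ss by (rule plug_forest_caret) (use nary_us i in \<open>auto simp: xs_def\<close>)
    have len': "length ?c = num_leaves A" "length ?c = num_leaves B"
      using len c by (metis length_list_update length_replicate)+
    have len_ss': "length ?ss' = sum_list (map num_leaves ?c)"
      using nary_us(1) i by (simp add: xs_def sum_list_replicate)
    have plug: "plug (plug A ?c) ?ss' = plug A ss" "plug (plug B ?c) ?ss' = plug B ss"
      using plug_plug[OF _ len_ss'] len' plug_c by simp_all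
    have "\<forall>s\<in>set ?ss'. nary n s" 
      using nary_us(2) less.prems(2) unfolding ss grafts_def by simp blast
    then have "?ss' \<in> grafts n (plug A ?c)"
      using len_ss' len' by (simp add: grafts_def num_leaves_plug)
    moreover have "sum_list (map size us) \<le> size_list size us" by (induction us) simp_all
    then have "sum_list (map size ?ss') < sum_list (map size ss)" unfolding ss by simp
    moreover have "(plug A ?c, plug B ?c) \<in> tree_pairs n"
      using expands_target[OF insertion_expands[OF step]] .
    ultimately have "((plug A ?c, plug B ?c), (plug A ss, plug B ss)) \<in> (insertion n)\<^sup>*"
      using less.hyps[of ?ss' "plug A ?c" "plug B ?c"] plug by simp
    with step show ?thesis by (rule converse_rtrancl_into_rtrancl)
  qed
qed

theorem pair_equiv_iff:
  "(x, y) \<in> pair_equiv n \<longleftrightarrow> (\<exists>z. expands n x z \<and> expands n y z)"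
proof
  let ?r = "insertion n \<union> (insertion n)\<inverse>"
  assume "(x, y) \<in> pair_equiv n"
  then have "(x, y) \<in> ?r\<^sup>*" "x \<in> tree_pairs n" by (auto simp: pair_equiv_def)
  then show "\<exists>z. expands n x z \<and> expands n y z"
  proof (induction rule: rtrancl_induct)
    case base
    then show ?case using expands_refl by blast
  next
    case (step y y')
    then obtain z where z: "expands n x z" "expands n y z" by blast
    have "(y, y') \<in> insertion n \<or> (y', y) \<in> insertion n" using step by auto
    then obtain w where "expands n y w" "expands n y' w"
      using insertion_expands expands_refl expands_source expands_target by meson
    then show ?case using common_expansion_trans z by blast
  qed
next
  let ?r = "insertion n \<union> (insertion n)\<inverse>"
  have *: "(x, z) \<in> (insertion n)\<^sup>*" if "expands n x z" for x z
    using that by (induction rule: expands.induct) (rule expands_rtrancl_insertion)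
  assume "\<exists>z. expands n x z \<and> expands n y z"
  then obtain z where z: "expands n x z" "expands n y z" by blast
  have "(x, z) \<in> ?r\<^sup>*" using *[OF z(1)] rtrancl_mono[of "insertion n" ?r] by blast
  moreover have "(z, y) \<in> ((insertion n)\<inverse>)\<^sup>*" using *[OF z(2)] by (simp add: rtrancl_converse)
  then have "(z, y) \<in> ?r\<^sup>*" using rtrancl_mono[of "(insertion n)\<inverse>" ?r] by blast
  ultimately have "(x, y) \<in> ?r\<^sup>*" by simp
  then show "(x, y) \<in> pair_equiv n"
    using z expands_source by (simp add: pair_equiv_def)
qed

lemma equiv_pair_equiv: "equiv (tree_pairs n) (pair_equiv n)"
proof (rule equivI)
  show "refl_on (tree_pairs n) (pair_equiv n)"
    by (rule refl_onI) (use expands_refl in \<open>unfold pair_equiv_iff, blast\<close>)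
  show "pair_equiv n \<subseteq> tree_pairs n \<times> tree_pairs n"
    by (auto simp: pair_equiv_def)
  show "sym (pair_equiv n)" by (rule symI) (unfold pair_equiv_iff, blast)
  show "trans (pair_equiv n)"
    by (rule transI) (use common_expansion_trans in \<open>unfold pair_equiv_iff, blast\<close>)
qed

lemma pair_class_eq_iff:
  "x \<in> tree_pairs n \<Longrightarrow> y \<in> tree_pairs n \<Longrightarrow>
    pair_class n x = pair_class n y \<longleftrightarrow> (\<exists>z. expands n x z \<and> expands n y z)"
  unfolding pair_class_def pair_equiv_iff[symmetric]
  by (rule eq_equiv_class_iff[OF equiv_pair_equiv])

lemma mem_pair_class_iff: "y \<in> pair_class n x \<longleftrightarrow> (\<exists>z. expands n x z \<and> expands n y z)"
  by (simp add: pair_class_def pair_equiv_iff)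

lemma pair_class_expands: "expands n x y \<Longrightarrow> pair_class n x = pair_class n y"
  using pair_class_eq_iff expands_source expands_target expands_refl by metis


section \<open>The Brown--Thompson groups\<close>

lemma carrier_brown_thompson: "carrier (brown_thompson n) = pair_class n ` tree_pairs n"
  by (auto simp: brown_thompson_def quotient_def pair_class_def)

lemma carrier_brown_thompsonE:
  assumes "X \<in> carrier (brown_thompson n)"
  obtains A B where "(A, B) \<in> tree_pairs n" "X = pair_class n (A, B)"
  using assms unfolding carrier_brown_thompson by (metis imageE surj_pair)

text \<open>Independence of representatives: common expansions of the two first factors and of the
  two second factors need not match in the middle, but after expanding further to a common middle tree
  they do, and composing them gives a common expansion of the two products.\<close>

lemma mult_pair_class:
  assumes "(A, B) \<in> tree_pairs n" "(B, C) \<in> tree_pairs n"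
  shows "pair_class n (A, B) \<otimes>\<^bsub>brown_thompson n\<^esub> pair_class n (B, C) = pair_class n (A, C)"
proof -
  have AC: "(A, C) \<in> tree_pairs n" using assms by (simp add: tree_pairs_iff)
  have "pair_class n (A', C') = pair_class n (A, C)"
    if mem: "(A', B') \<in> pair_class n (A, B)" "(B', C') \<in> pair_class n (B, C)" for A' B' C'
  proof -
    obtain P Q where PQ: "expands n (A, B) (P, Q)" "expands n (A', B') (P, Q)"
      using mem(1) by (auto simp: mem_pair_class_iff)
    obtain R S where RS: "expands n (B, C) (R, S)" "expands n (B', C') (R, S)"
      using mem(2) by (auto simp: mem_pair_class_iff)
    obtain M P' S' where M: "expands n (Q, P) (M, P')" "expands n (R, S) (M, S')"
      using expands_to_common_full[OF expands_target[OF expands_swap[OF PQ(1)]] expands_target[OF RS(1)]]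
      by metis
    have "expands n (A, C) (P', S')" "expands n (A', C') (P', S')"
      by (meson M PQ RS expands_compose expands_swap expands_trans)+
    then show ?thesis using pair_class_expands by metis
  qed
  moreover have "(A, B) \<in> pair_class n (A, B)" "(B, C) \<in> pair_class n (B, C)"
    using assms expands_refl unfolding mem_pair_class_iff by blast+
  ultimately have "{pair_class n (A', C') | A' B' C'.
      (A', B') \<in> pair_class n (A, B) \<and> (B', C') \<in> pair_class n (B, C)} = {pair_class n (A, C)}"
    by blast
  then show ?thesis by (simp add: brown_thompson_def)
qed

lemma matching_representatives:
  assumes "(A, B) \<in> tree_pairs n" "Y \<in> carrier (brown_thompson n)"
  obtains A' B' C' where "expands n (A, B) (A', B')" "(B', C') \<in> tree_pairs n" "Y = pair_class n (B', C')"
proof -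
  obtain R S where RS: "(R, S) \<in> tree_pairs n" "Y = pair_class n (R, S)"
    using assms(2) by (rule carrier_brown_thompsonE)
  obtain M A' S' where "expands n (B, A) (M, A')" "expands n (R, S) (M, S')"
    using expands_to_common_full[of "(B, A)" n "(R, S)"] assms(1) RS(1) by (metis tree_pairs_iff)
  then show ?thesis
    using that[of A' M S'] RS(2) expands_swap expands_target pair_class_expands by metis
qed

lemma one_brown_thompson:
  assumes "nary n A"
  shows "pair_class n (A, A) = \<one>\<^bsub>brown_thompson n\<^esub>"
proof -
  have "expands n (Leaf, Leaf) (plug Leaf [A], plug Leaf [A])"
    using assms by (intro expandsI) (simp_all add: tree_pairs_iff grafts_def)
  then show ?thesis using pair_class_expands by (simp add: brown_thompson_def)
qed

theorem group_brown_thompson: "group (brown_thompson n)" (is "group ?G")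
proof (rule groupI)
  have Leaf: "(Leaf, Leaf) \<in> tree_pairs n" by (simp add: tree_pairs_iff)
  have one: "\<one>\<^bsub>?G\<^esub> = pair_class n (Leaf, Leaf)" by (simp add: brown_thompson_def)
  show "\<one>\<^bsub>?G\<^esub> \<in> carrier ?G" unfolding one carrier_brown_thompson using Leaf by blast
  show "X \<otimes>\<^bsub>?G\<^esub> Y \<in> carrier ?G" if X: "X \<in> carrier ?G" and Y: "Y \<in> carrier ?G" for X Y
  proof -
    obtain A B where AB: "(A, B) \<in> tree_pairs n" "X = pair_class n (A, B)"
      using X by (rule carrier_brown_thompsonE)
    obtain A' B' C' where exp: "expands n (A, B) (A', B')" and Y': "(B', C') \<in> tree_pairs n"
      "Y = pair_class n (B', C')"
      by (rule matching_representatives[OF AB(1) Y])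
    then have "X \<otimes>\<^bsub>?G\<^esub> Y = pair_class n (A', C')" "(A', C') \<in> tree_pairs n"
      using mult_pair_class[OF expands_target[OF exp] Y'(1)] expands_target[OF exp]
        pair_class_expands[OF exp] AB(2) by (simp_all add: tree_pairs_iff)
    then show ?thesis by (simp add: carrier_brown_thompson)
  qed
  show "\<one>\<^bsub>?G\<^esub> \<otimes>\<^bsub>?G\<^esub> X = X" if X: "X \<in> carrier ?G" for X
  proof -
    obtain A B where AB: "(A, B) \<in> tree_pairs n" "X = pair_class n (A, B)"
      using X by (rule carrier_brown_thompsonE)
    then show ?thesis using mult_pair_class[of A A n B] one_brown_thompson[of n A] by (simp add: tree_pairs_iff)
  qed
  show "\<exists>Y\<in>carrier ?G. Y \<otimes>\<^bsub>?G\<^esub> X = \<one>\<^bsub>?G\<^esub>" if X: "X \<in> carrier ?G" for X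
  proof -
    obtain A B where AB: "(A, B) \<in> tree_pairs n" "X = pair_class n (A, B)"
      using X by (rule carrier_brown_thompsonE)
    then have BA: "(B, A) \<in> tree_pairs n" by (simp add: tree_pairs_iff)
    have "pair_class n (B, A) \<otimes>\<^bsub>?G\<^esub> X = \<one>\<^bsub>?G\<^esub>"
      using mult_pair_class[OF BA AB(1)] one_brown_thompson[of n B] AB by (simp add: tree_pairs_iff)
    then show ?thesis using BA by (auto simp: carrier_brown_thompson)
  qed
  show "X \<otimes>\<^bsub>?G\<^esub> Y \<otimes>\<^bsub>?G\<^esub> Z = X \<otimes>\<^bsub>?G\<^esub> (Y \<otimes>\<^bsub>?G\<^esub> Z)"
    if X: "X \<in> carrier ?G" and Y: "Y \<in> carrier ?G" and Z: "Z \<in> carrier ?G" for X Y Z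
  proof -
    obtain A B where AB: "(A, B) \<in> tree_pairs n" "X = pair_class n (A, B)"
      using X by (rule carrier_brown_thompsonE)
    obtain A1 B1 C1 where XY: "expands n (A, B) (A1, B1)" "(B1, C1) \<in> tree_pairs n"
      "Y = pair_class n (B1, C1)"
      by (rule matching_representatives[OF AB(1) Y])
    obtain B2 C2 D2 where YZ: "expands n (B1, C1) (B2, C2)" "(C2, D2) \<in> tree_pairs n"
      "Z = pair_class n (C2, D2)"
      by (rule matching_representatives[OF XY(2) Z])
    obtain ss where ss: "ss \<in> grafts n B1" "B2 = plug B1 ss"
      using YZ(1) by (auto elim: expands.cases)
    have A1B1: "(A1, B1) \<in> tree_pairs n" by (rule expands_target[OF XY(1)])
    then have A2: "expands n (A1, B1) (plug A1 ss, B2)"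
      unfolding ss using ss grafts_cong[of A1 B1] by (intro expandsI) (simp_all add: tree_pairs_iff)
    have "X = pair_class n (plug A1 ss, B2)" "Y = pair_class n (B2, C2)"
      using AB(2) XY(3) pair_class_expands[OF XY(1)] pair_class_expands[OF A2] pair_class_expands[OF YZ(1)]
      by simp_all
    moreover have "(plug A1 ss, B2) \<in> tree_pairs n" "(B2, C2) \<in> tree_pairs n"
      using expands_target[OF A2] expands_target[OF YZ(1)] .
    moreover have "(plug A1 ss, C2) \<in> tree_pairs n" "(B2, D2) \<in> tree_pairs n"
      using calculation(3,4) YZ(2) by (simp_all add: tree_pairs_iff)
    ultimately show ?thesis using YZ(2,3) by (simp add: mult_pair_class)
  qed
qed


section \<open>Replacing carets\<close>

lemma depths_complete_tree [simp]: "depths (complete_tree q) = replicate (2 ^ q) q"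
  by (induction q) (simp_all add: mult_2 replicate_add)

lemma num_leaves_complete_tree [simp]: "num_leaves (complete_tree q) = 2 ^ q"
  using length_depths[of "complete_tree q"] by simp

lemma nary_complete_tree [simp]: "nary 2 (complete_tree q)"
  by (induction q) simp_all

lemma complete_tree_eq_full: "complete_tree q = full 2 q"
  by (induction q) (simp_all add: numeral_2_eq_2)

lemma num_leaves_binarize [simp]: "nary (2 ^ q) A \<Longrightarrow> num_leaves (binarize q A) = num_leaves A"
proof (induction A)
  case (Node ts)
  then have "map (num_leaves \<circ> binarize q) ts = map num_leaves ts" by simp
  with Node.prems show ?case by (simp add: num_leaves_plug del: map_eq_conv)
qed simp

lemma nary_binarize: "nary (2 ^ q) A \<Longrightarrow> nary 2 (binarize q A)"
proof (induction A)
  case (Node ts)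
  then have "\<forall>s\<in>set (map (binarize q) ts). nary 2 s" by simp
  then show ?case
    unfolding binarize.simps by (rule nary_plug[rotated 2]) (use Node.prems in simp_all)
qed simp

lemma depths_plug_complete_tree:
  "length ss = 2 ^ q \<Longrightarrow>
    depths (plug (complete_tree q) ss) = concat (map (\<lambda>s. map ((+) q) (depths s)) ss)"
  by (simp add: depths_plug zip_replicate1 comp_def)

lemma depths_binarize: "nary (2 ^ q) A \<Longrightarrow> depths (binarize q A) = map ((*) q) (depths A)"
proof (induction A)
  case (Node ts)
  then have "map (\<lambda>t. map ((+) q) (depths (binarize q t))) ts =
      map (\<lambda>t. map (\<lambda>d. q * Suc d) (depths t)) ts"
    by simp
  note subtrees = arg_cong[OF this, of concat]
  have "depths (binarize q (Node ts)) = concat (map (\<lambda>t. map ((+) q) (depths (binarize q t))) ts)"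
    using Node.prems by (simp add: depths_plug_complete_tree comp_def)
  also note subtrees
  also have "concat (map (\<lambda>t. map (\<lambda>d. q * Suc d) (depths t)) ts) = map ((*) q) (depths (Node ts))"
    by (simp add: map_concat comp_def)
  finally show ?case .
qed simp

lemma binarize_inject:
  assumes "0 < q" "nary (2 ^ q) A" "nary (2 ^ q) B" "binarize q A = binarize q B"
  shows "A = B"
proof (rule depths_inject[OF _ assms(2,3)])
  have "map ((*) q) (depths A) = map ((*) q) (depths B)"
    using assms depths_binarize by metis
  then show "depths A = depths B"
    by (rule map_injective) (use assms(1) in \<open>simp add: inj_on_def\<close>)
qed simp

lemma binarize_plug:
  "nary (2 ^ q) t \<Longrightarrow> length ss = num_leaves t \<Longrightarrow>
    binarize q (plug t ss) = plug (binarize q t) (map (binarize q) ss)"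
  and binarize_plug_forest:
  "\<forall>t\<in>set ts. nary (2 ^ q) t \<Longrightarrow> length ss = sum_list (map num_leaves ts) \<Longrightarrow>
    map (binarize q) (plug_forest ts ss) = plug_forest (map (binarize q) ts) (map (binarize q) ss)"
proof (induction t ss and ts ss rule: plug_plug_forest.induct)
  case (1 ss)
  then show ?case by (cases ss) auto
next
  case (2 ts ss)
  have ts: "length ts = 2 ^ q" "\<forall>t\<in>set ts. nary (2 ^ q) t" using 2(2) by simp_all
  then have "map (num_leaves \<circ> binarize q) ts = map num_leaves ts" by simp
  then have "length (map (binarize q) ss) = sum_list (map num_leaves (map (binarize q) ts))"
    using 2(3) by (simp del: map_eq_conv)
  then show ?case using 2(1)[OF ts(2)] 2(3) ts(1) by (simp add: plug_plug)
next
  case (4 t ts ss)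
  then show ?case by (simp add: take_map drop_map)
qed simp_all

lemma nary_2_cases:
  assumes "nary 2 t"
  obtains "t = Leaf" | l r where "t = Node [l, r]" "nary 2 l" "nary 2 r"
proof (cases t)
  case (Node ts)
  then obtain l r where "ts = [l, r]"
    using assms by (auto simp: numeral_2_eq_2 length_Suc_conv)
  then show ?thesis using that Node assms by simp
qed (use that in simp)

text \<open>If no leaf lies above level \<open>q\<close>, the tree contains all vertices of the complete tree of
  depth \<open>q\<close>.\<close>

lemma plug_complete_tree:
  "nary 2 t \<Longrightarrow> \<forall>d\<in>set (depths t). q \<le> d \<Longrightarrow>
    \<exists>ss. length ss = 2 ^ q \<and> (\<forall>s\<in>set ss. nary 2 s) \<and> t = plug (complete_tree q) ss"
proof (induction q arbitrary: t)
  case 0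
  then show ?case by (intro exI[of _ "[t]"]) simp
next
  case (Suc q)
  from Suc.prems(1) show ?case
  proof (cases rule: nary_2_cases)
    case 1
    then show ?thesis using Suc.prems(2) by simp
  next
    case (2 l r)
    have "\<forall>d\<in>set (depths l). q \<le> d" "\<forall>d\<in>set (depths r). q \<le> d"
      using Suc.prems(2) unfolding 2(1) by auto
    then obtain ss rs where
      ss: "length ss = 2 ^ q" "\<forall>s\<in>set ss. nary 2 s" "l = plug (complete_tree q) ss" and
      rs: "length rs = 2 ^ q" "\<forall>s\<in>set rs. nary 2 s" "r = plug (complete_tree q) rs"
      using Suc.IH[of l] Suc.IH[of r] 2(2,3) by blast
    have "length (ss @ rs) = 2 ^ Suc q" "t = plug (complete_tree (Suc q)) (ss @ rs)"
      using ss(1,3) rs(1,3) 2(1) by simp_all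
    moreover have "\<forall>s\<in>set (ss @ rs). nary 2 s"
      using ss(2) rs(2) unfolding set_append by blast
    ultimately show ?thesis by blast
  qed
qed

text \<open>A binary tree whose leaf depths are all multiples of \<open>q\<close> is cut by the levels
  \<open>0, q, 2 * q, \<dots>\<close> into copies of the complete tree of depth \<open>q\<close>.
  Below level \<open>q\<close> all depths drop by \<open>q\<close>, so induction on the bound \<open>m\<close> reaches these subtrees.\<close>

lemma ex_binarize:
  assumes "0 < q"
  shows "nary 2 t \<Longrightarrow> \<forall>d\<in>set (depths t). d < m \<Longrightarrow> \<forall>d\<in>set (depths t). q dvd d \<Longrightarrow>
    \<exists>A. nary (2 ^ q) A \<and> binarize q A = t"
proof (induction m arbitrary: t)
  case 0
  then have "depths t = []" by simp
  then have "num_leaves t = 0" using length_depths[of t] by simp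
  then show ?case using num_leaves_pos[of 2 t] 0(1) by simp
next
  case (Suc m)
  show ?case
  proof (cases "t = Leaf")
    case True
    then show ?thesis by (intro exI[of _ Leaf]) simp
  next
    case False
    then have "\<forall>d\<in>set (depths t). 0 < d" using Suc.prems(1) by (cases t) auto
    then have "\<forall>d\<in>set (depths t). q \<le> d" using Suc.prems(3) by (simp add: dvd_imp_le)
    then obtain ss where ss: "length ss = 2 ^ q" "\<forall>s\<in>set ss. nary 2 s" "t = plug (complete_tree q) ss"
      using plug_complete_tree Suc.prems(1) by blast
    have sub: "q + d \<in> set (depths t)" if "s \<in> set ss" "d \<in> set (depths s)" for s d
      using that unfolding ss(3) depths_plug_complete_tree[OF ss(1)] by auto
    have "\<exists>A. nary (2 ^ q) A \<and> binarize q A = s" if s: "s \<in> set ss" for s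
    proof (rule Suc.IH)
      show "nary 2 s" using ss(2) s by blast
      show "\<forall>d\<in>set (depths s). d < m"
      proof
        fix d assume "d \<in> set (depths s)"
        then have "q + d < Suc m" using sub[OF s] Suc.prems(2) by blast
        then show "d < m" using assms by linarith
      qed
      show "\<forall>d\<in>set (depths s). q dvd d"
        using sub[OF s] Suc.prems(3) by (metis dvd_add_right_iff dvd_refl)
    qed
    then obtain f where f: "\<And>s. s \<in> set ss \<Longrightarrow> nary (2 ^ q) (f s)" "\<And>s. s \<in> set ss \<Longrightarrow> binarize q (f s) = s"
      by metis
    have "map (binarize q) (map f ss) = ss" using f(2) by (simp add: map_idI)
    then have "binarize q (Node (map f ss)) = t" unfolding ss(3) binarize.simps by simp
    moreover have "nary (2 ^ q) (Node (map f ss))" using f(1) ss(1) by simp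
    ultimately show ?thesis by blast
  qed
qed

lemma binarize_surj:
  assumes "0 < q" "nary 2 t" "\<forall>d\<in>set (depths t). q dvd d"
  obtains A where "nary (2 ^ q) A" "binarize q A = t"
proof -
  have "\<forall>d\<in>set (depths t). d < Suc (Max (set (depths t)))" by (simp add: less_Suc_eq_le)
  then show ?thesis using ex_binarize assms that by blast
qed


section \<open>The caret replacement homomorphism\<close>

lemma binarize_pair:
  "(A, B) \<in> tree_pairs (2 ^ q) \<Longrightarrow> (binarize q A, binarize q B) \<in> tree_pairs 2"
  by (simp add: tree_pairs_iff nary_binarize)

text \<open>Grafting commutes with replacing carets, so \<open>ss\<close> becomes \<open>map (binarize q) ss\<close>.\<close>

lemma binarize_expands:
  assumes "expands (2 ^ q) (A, B) (A', B')"
  shows "expands 2 (binarize q A, binarize q B) (binarize q A', binarize q B')"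
proof -
  obtain ss where ss: "ss \<in> grafts (2 ^ q) A" "A' = plug A ss" "B' = plug B ss"
    and AB: "(A, B) \<in> tree_pairs (2 ^ q)"
    using assms by (auto elim: expands.cases)
  have len: "length ss = num_leaves A" "length ss = num_leaves B"
    using ss(1) AB by (simp_all add: grafts_def tree_pairs_iff)
  have "map (binarize q) ss \<in> grafts 2 (binarize q A)"
    using AB len(1) graft_nary[OF ss(1)] nary_binarize by (auto simp: grafts_def tree_pairs_iff)
  from expandsI[OF binarize_pair[OF AB] this] show ?thesis
    unfolding ss using AB len binarize_plug by (simp add: tree_pairs_iff)
qed

lemma phi_pair_class:
  assumes "(A, B) \<in> tree_pairs (2 ^ q)"
  shows "phi q (pair_class (2 ^ q) (A, B)) = pair_class 2 (binarize q A, binarize q B)"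
proof -
  have "pair_class 2 (binarize q C, binarize q D) = pair_class 2 (binarize q A, binarize q B)"
    if "(C, D) \<in> pair_class (2 ^ q) (A, B)" for C D
  proof -
    obtain P Q where "expands (2 ^ q) (A, B) (P, Q)" "expands (2 ^ q) (C, D) (P, Q)"
      using \<open>(C, D) \<in> pair_class (2 ^ q) (A, B)\<close> unfolding mem_pair_class_iff by (metis surj_pair)
    then show ?thesis using binarize_expands pair_class_expands by metis
  qed
  moreover have "(A, B) \<in> pair_class (2 ^ q) (A, B)"
    using assms expands_refl unfolding mem_pair_class_iff by blast
  ultimately show ?thesis unfolding phi_def by blast
qed

lemma phi_hom: "phi q \<in> hom (brown_thompson (2 ^ q)) thompson_F"
proof (rule homI)
  let ?n = "2 ^ q :: nat"
  show "phi q X \<in> carrier thompson_F" if X: "X \<in> carrier (brown_thompson ?n)" for X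
  proof -
    obtain A B where "(A, B) \<in> tree_pairs ?n" "X = pair_class ?n (A, B)"
      using X by (rule carrier_brown_thompsonE)
    then show ?thesis using binarize_pair by (simp add: phi_pair_class carrier_brown_thompson)
  qed
  show "phi q (X \<otimes>\<^bsub>brown_thompson ?n\<^esub> Y) = phi q X \<otimes>\<^bsub>thompson_F\<^esub> phi q Y"
    if X: "X \<in> carrier (brown_thompson ?n)" and Y: "Y \<in> carrier (brown_thompson ?n)" for X Y
  proof -
    obtain A B where AB: "(A, B) \<in> tree_pairs ?n" "X = pair_class ?n (A, B)"
      using X by (rule carrier_brown_thompsonE)
    obtain A' B' C' where exp: "expands ?n (A, B) (A', B')" and BC: "(B', C') \<in> tree_pairs ?n"
      "Y = pair_class ?n (B', C')"
      by (rule matching_representatives[OF AB(1) Y])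
    have AB': "(A', B') \<in> tree_pairs ?n" "X = pair_class ?n (A', B')"
      using expands_target[OF exp] pair_class_expands[OF exp] AB(2) by simp_all
    then have AC: "(A', C') \<in> tree_pairs ?n" using BC(1) by (simp add: tree_pairs_iff)
    show ?thesis
      unfolding AB'(2) BC(2) mult_pair_class[OF AB'(1) BC(1)] phi_pair_class[OF AB'(1)]
        phi_pair_class[OF BC(1)] phi_pair_class[OF AC]
      using mult_pair_class[OF binarize_pair[OF AB'(1)] binarize_pair[OF BC(1)]] by simp
  qed
qed

lemma group_hom_phi: "group_hom (brown_thompson (2 ^ q)) thompson_F (phi q)"
  by (simp add: group_hom_def group_hom_axioms_def group_brown_thompson phi_hom)

lemma pair_class_eq_one_iff:
  assumes "0 < n" "(A, B) \<in> tree_pairs n"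
  shows "pair_class n (A, B) = \<one>\<^bsub>brown_thompson n\<^esub> \<longleftrightarrow> A = B"
proof
  assume "A = B"
  then show "pair_class n (A, B) = \<one>\<^bsub>brown_thompson n\<^esub>"
    using assms(2) one_brown_thompson by (simp add: tree_pairs_iff)
next
  have Leaf: "(Leaf, Leaf) \<in> tree_pairs n" by (simp add: tree_pairs_iff)
  assume "pair_class n (A, B) = \<one>\<^bsub>brown_thompson n\<^esub>"
  then have "pair_class n (A, B) = pair_class n (Leaf, Leaf)" by (simp add: brown_thompson_def)
  then obtain z where z: "expands n (A, B) z" "expands n (Leaf, Leaf) z"
    using pair_class_eq_iff[OF assms(2) Leaf] by blast
  from z(2) obtain C where "z = (C, C)" by (auto elim: expands.cases)
  then show "A = B" using expands_diagonal[OF assms(1)] z(1) by blast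
qed

text \<open>A class in the kernel has a representative pair that becomes trivial after caret replacement, and
  triviality can be tested on any representative by comparing its two trees.\<close>

lemma inj_on_phi:
  assumes "0 < q"
  shows "inj_on (phi q) (carrier (brown_thompson (2 ^ q)))"
proof -
  interpret group_hom "brown_thompson (2 ^ q)" thompson_F "phi q" by (rule group_hom_phi)
  have "X = \<one>\<^bsub>brown_thompson (2 ^ q)\<^esub>"
    if X: "X \<in> carrier (brown_thompson (2 ^ q))" "phi q X = \<one>\<^bsub>thompson_F\<^esub>" for X
  proof -
    obtain A B where AB: "(A, B) \<in> tree_pairs (2 ^ q)" "X = pair_class (2 ^ q) (A, B)"
      using X(1) by (rule carrier_brown_thompsonE)
    then have "pair_class 2 (binarize q A, binarize q B) = \<one>\<^bsub>thompson_F\<^esub>"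
      using X(2) by (simp add: phi_pair_class)
    then have "binarize q A = binarize q B"
      using pair_class_eq_one_iff[OF _ binarize_pair[OF AB(1)]] by simp
    then have "A = B" using binarize_inject[OF assms] AB(1) by (simp add: tree_pairs_iff)
    then show ?thesis using pair_class_eq_one_iff[OF _ AB(1)] AB(2) by simp
  qed
  then show ?thesis using inj_on_one_iff by blast
qed


section \<open>Colorability in terms of leaf depths\<close>

lemma rho_Cons: "rho (a # w) = (of_nat a + rho w) / 2"
  unfolding rho_def length_Cons sum.lessThan_Suc_shift
  by (simp add: sum_divide_distrib[symmetric] add_divide_distrib sum_divide_distrib)

abbreviation total_width :: "nat list \<Rightarrow> rat" where
  "total_width ds \<equiv> (\<Sum>d\<leftarrow>ds. 1 / 2 ^ d)"

lemma total_width_Suc: "total_width (map Suc ds) = total_width ds / 2"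
  by (induction ds) (simp_all add: add_divide_distrib)

lemma total_width_depths: "nary 2 t \<Longrightarrow> total_width (depths t) = 1"
proof (induction t)
  case (Node ts)
  from Node.prems show ?case
  proof (cases rule: nary_2_cases)
    case (2 l r)
    then have "total_width (depths l) = 1" "total_width (depths r) = 1" using Node.IH by simp_all
    moreover have "depths (Node ts) = map Suc (depths l @ depths r)" using 2 by simp
    ultimately show ?thesis by (simp only: total_width_Suc) simp
  qed simp
qed simp

text \<open>The dyadic interval of a leaf begins where the interval of the previous leaf ends.\<close>

lemma rho_leaves:
  "nary 2 t \<Longrightarrow> i < num_leaves t \<Longrightarrow> rho (leaves t ! i) = total_width (take i (depths t))"
proof (induction t arbitrary: i)
  case Leaf
  then show ?case by (simp add: rho_def)
next
  case (Node ts)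
  from Node.prems(1) show ?case
  proof (cases rule: nary_2_cases)
    case (2 l r)
    then have IH: "\<And>i. i < num_leaves l \<Longrightarrow> rho (leaves l ! i) = total_width (take i (depths l))"
      "\<And>i. i < num_leaves r \<Longrightarrow> rho (leaves r ! i) = total_width (take i (depths r))"
      using Node.IH by simp_all
    have lvs: "leaves (Node ts) = map ((#) 0) (leaves l) @ map ((#) 1) (leaves r)"
      using 2(1) by (simp add: leaves.simps(2))
    have dps: "depths (Node ts) = map Suc (depths l @ depths r)" using 2(1) by simp
    show ?thesis
    proof (cases "i < num_leaves l")
      case True
      then show ?thesis
        unfolding dps take_map total_width_Suc using IH(1) by (simp add: lvs nth_append rho_Cons)
    next
      case False
      have "i - num_leaves l < num_leaves r" using False Node.prems(2) 2(1) by simp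
      with False show ?thesis
        unfolding dps take_map total_width_Suc
        using IH(2) total_width_depths[OF 2(2)] by (simp add: lvs nth_append rho_Cons)
    qed
  qed simp
qed

lemma dyadic_add: "x \<in> dyadic \<Longrightarrow> y \<in> dyadic \<Longrightarrow> x + y \<in> dyadic"
proof -
  assume "x \<in> dyadic" "y \<in> dyadic"
  then obtain a k b m where xy: "x = of_int a / 2 ^ k" "y = of_int b / 2 ^ m"
    unfolding dyadic_def by blast
  have "x + y = of_int (a * 2 ^ m + b * 2 ^ k) / 2 ^ (k + m)"
    unfolding xy by (simp add: field_simps power_add)
  then show ?thesis unfolding dyadic_def by blast
qed

lemma dyadic_uminus: "x \<in> dyadic \<Longrightarrow> - x \<in> dyadic"
  unfolding dyadic_def by clarify (metis minus_divide_left of_int_minus)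

lemma dyadic_cong_refl: "dyadic_cong p x x"
  unfolding dyadic_cong_def dyadic_def by (intro bexI[of _ 0]) (auto intro: exI[of _ 0])

lemma dyadic_cong_add:
  assumes "dyadic_cong p x y" "dyadic_cong p u v"
  shows "dyadic_cong p (x + u) (y + v)"
proof -
  obtain c d where "c \<in> dyadic" "d \<in> dyadic" "x - y = of_nat p * c" "u - v = of_nat p * d"
    using assms unfolding dyadic_cong_def by blast
  then show ?thesis
    unfolding dyadic_cong_def by (intro bexI[of _ "c + d"] dyadic_add) (simp_all add: algebra_simps)
qed

lemma dyadic_cong_diff:
  assumes "dyadic_cong p x y" "dyadic_cong p u v"
  shows "dyadic_cong p (x - u) (y - v)"
proof -
  obtain c d where "c \<in> dyadic" "d \<in> dyadic" "x - y = of_nat p * c" "u - v = of_nat p * d"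
    using assms unfolding dyadic_cong_def by blast
  then show ?thesis
    unfolding dyadic_cong_def
    by (intro bexI[of _ "c + - d"] dyadic_add dyadic_uminus) (simp_all add: algebra_simps)
qed

text \<open>Denominators are powers of \<open>2\<close>, hence invertible modulo the odd number \<open>p\<close>, and
  \<open>1 / 2^d - 1 / 2^e = (2^e - 2^d) / 2^(d + e)\<close>.\<close>

lemma dyadic_cong_width_iff:
  assumes "odd p"
  shows "dyadic_cong p (1 / 2 ^ d) (1 / 2 ^ e) \<longleftrightarrow> [2 ^ d = 2 ^ e] (mod p)"
proof -
  have diff: "1 / 2 ^ d - 1 / 2 ^ e = (of_int (2 ^ e - 2 ^ d) :: rat) / 2 ^ (d + e)"
    by (simp add: field_simps power_add)
  have "[2 ^ d = 2 ^ e] (mod p) \<longleftrightarrow> int p dvd 2 ^ e - 2 ^ d"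
    unfolding cong_int_iff[symmetric] cong_iff_dvd_diff by (simp add: dvd_diff_commute)
  also have "\<dots> \<longleftrightarrow> dyadic_cong p (1 / 2 ^ d) (1 / 2 ^ e)"
  proof
    assume "int p dvd 2 ^ e - 2 ^ d"
    then obtain m where "(2 ^ e - 2 ^ d :: int) = int p * m" by blast
    then have "(1 / 2 ^ d - 1 / 2 ^ e :: rat) = of_nat p * (of_int m / 2 ^ (d + e))"
      unfolding diff by simp
    then show "dyadic_cong p (1 / 2 ^ d) (1 / 2 ^ e)" unfolding dyadic_cong_def dyadic_def by blast
  next
    assume "dyadic_cong p (1 / 2 ^ d) (1 / 2 ^ e)"
    then obtain a k where "(of_int (2 ^ e - 2 ^ d) :: rat) / 2 ^ (d + e) = of_nat p * (of_int a / 2 ^ k)"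
      unfolding dyadic_cong_def dyadic_def diff by blast
    then have "(of_int ((2 ^ e - 2 ^ d) * 2 ^ k) :: rat) = of_int (int p * (a * 2 ^ (d + e)))"
      by (simp add: field_simps)
    then have "(2 ^ e - 2 ^ d) * 2 ^ k = int p * (a * 2 ^ (d + e))" by (simp only: of_int_eq_iff)
    then have "int p dvd (2 ^ e - 2 ^ d) * 2 ^ k" by simp
    moreover have "coprime (int p) (2 ^ k)" using assms by simp
    ultimately show "int p dvd 2 ^ e - 2 ^ d" using coprime_dvd_mult_left_iff by blast
  qed
  finally show ?thesis by simp
qed

text \<open>Widths are differences of consecutive endpoints. For the last leaf the next endpoint is
  \<open>1\<close> in both trees, which \<open>total_width_depths\<close> supplies because no further leaf begins there.\<close>

lemma colorable_pair_iff:
  assumes "odd p" "(A, B) \<in> tree_pairs 2"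
  shows "colorable_pair p (A, B) \<longleftrightarrow>
    (\<forall>i<num_leaves A. [depths A ! i = depths B ! i] (mod ord p 2))"
proof -
  let ?N = "num_leaves A"
  let ?S = "\<lambda>i. total_width (take i (depths A))" and ?S' = "\<lambda>i. total_width (take i (depths B))"
  have AB: "nary 2 A" "nary 2 B" "num_leaves B = ?N" using assms(2) by (simp_all add: tree_pairs_iff)
  have step: "?S (Suc i) = ?S i + 1 / 2 ^ (depths A ! i)" "?S' (Suc i) = ?S' i + 1 / 2 ^ (depths B ! i)"
    if "i < ?N" for i
    using that AB(3) by (simp_all add: take_Suc_conv_app_nth)
  have "colorable_pair p (A, B) \<longleftrightarrow> (\<forall>i<?N. dyadic_cong p (?S i) (?S' i))"
    using AB by (simp add: colorable_pair_def rho_leaves)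
  also have "\<dots> \<longleftrightarrow> (\<forall>i<?N. dyadic_cong p (1 / 2 ^ (depths A ! i)) (1 / 2 ^ (depths B ! i)))"
  proof
    assume L: "\<forall>i<?N. dyadic_cong p (?S i) (?S' i)"
    have "dyadic_cong p (?S ?N) (?S' ?N)"
      using AB total_width_depths[of A] total_width_depths[of B] by (simp add: dyadic_cong_refl)
    with L have L': "dyadic_cong p (?S i) (?S' i)" if "i \<le> ?N" for i
      using that by (cases "i = ?N") simp_all
    show "\<forall>i<?N. dyadic_cong p (1 / 2 ^ (depths A ! i)) (1 / 2 ^ (depths B ! i))"
    proof (intro allI impI)
      fix i assume i: "i < ?N"
      have "dyadic_cong p (?S (Suc i) - ?S i) (?S' (Suc i) - ?S' i)"
        by (intro dyadic_cong_diff L') (use i in simp_all)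
      then show "dyadic_cong p (1 / 2 ^ (depths A ! i)) (1 / 2 ^ (depths B ! i))"
        unfolding step[OF i] by simp
    qed
  next
    assume R: "\<forall>i<?N. dyadic_cong p (1 / 2 ^ (depths A ! i)) (1 / 2 ^ (depths B ! i))"
    have "dyadic_cong p (?S i) (?S' i)" if "i \<le> ?N" for i
      using that
    proof (induction i)
      case (Suc i)
      then have i: "i < ?N" by simp
      show ?case unfolding step[OF i] using Suc R by (intro dyadic_cong_add) simp_all
    qed (simp add: dyadic_cong_refl)
    then show "\<forall>i<?N. dyadic_cong p (?S i) (?S' i)" by simp
  qed
  also have "\<dots> \<longleftrightarrow> (\<forall>i<?N. [depths A ! i = depths B ! i] (mod ord p 2))"
    using assms(1) by (simp add: dyadic_cong_width_iff order_divides_expdiff)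
  finally show ?thesis .
qed


section \<open>The image of the caret replacement map\<close>

lemma set_depths_plug:
  "length ss = num_leaves t \<Longrightarrow>
    set (depths (plug t ss)) = (\<Union>i<num_leaves t. (+) (depths t ! i) ` set (depths (ss ! i)))"
  by (auto simp: depths_plug set_zip)

text \<open>The leaves that a graft creates in \<open>A'\<close> and in \<open>B'\<close> lie equally far below corresponding leaves
  of \<open>A\<close> and \<open>B\<close>, so their depths are again congruent modulo \<open>q\<close>.\<close>

lemma expands_depths_dvd:
  assumes "expands n (A, B) (A', B')"
    and "\<forall>i<num_leaves A. [depths A ! i = depths B ! i] (mod q)"
    and "\<forall>d\<in>set (depths A'). q dvd d"
  shows "\<forall>d\<in>set (depths B'). q dvd d"
proof
  fix d assume d: "d \<in> set (depths B')"
  obtain ss where ss: "length ss = num_leaves A" "length ss = num_leaves B" "A' = plug A ss" "B' = plug B ss"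
    using assms(1) by (auto elim!: expands.cases simp: grafts_def tree_pairs_iff)
  obtain i e where i: "i < num_leaves A" "e \<in> set (depths (ss ! i))" "d = depths B ! i + e"
    using d ss(1,2) unfolding ss(4) set_depths_plug[OF ss(2)] by auto
  have "[depths A ! i + e = depths B ! i + e] (mod q)" using assms(2) i(1) by (simp add: cong_add)
  moreover have "depths A ! i + e \<in> set (depths A')"
    unfolding ss(3) set_depths_plug[OF ss(1)] using i by blast
  then have "q dvd depths A ! i + e" using assms(3) by blast
  ultimately show "q dvd d" unfolding i(3) using cong_dvd_iff by blast
qed

text \<open>Depths in the image are multiples of \<open>q\<close>, hence congruent. Conversely, once the first
  tree of an expansion of a colorable pair has all its leaves at depth \<open>q * K\<close>, both trees are in
  the range of \<open>binarize q\<close>.\<close>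

lemma phi_image:
  assumes "odd p"
  defines "q \<equiv> ord p 2"
  shows "phi q ` carrier (brown_thompson (2 ^ q)) = colorable_subgroup p"
proof (intro equalityI subsetI)
  fix Y assume "Y \<in> phi q ` carrier (brown_thompson (2 ^ q))"
  then obtain X where X: "X \<in> carrier (brown_thompson (2 ^ q))" "Y = phi q X" by blast
  obtain A B where AB: "(A, B) \<in> tree_pairs (2 ^ q)" "X = pair_class (2 ^ q) (A, B)"
    using X(1) by (rule carrier_brown_thompsonE)
  have nary: "nary (2 ^ q) A" "nary (2 ^ q) B" and num: "num_leaves A = num_leaves B"
    using AB(1) by (simp_all add: tree_pairs_iff)
  have "[depths (binarize q A) ! i = depths (binarize q B) ! i] (mod q)" if "i < num_leaves A" for i
    using that num unfolding depths_binarize[OF nary(1)] depths_binarize[OF nary(2)]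
    by (simp add: cong_def)
  then have "colorable_pair p (binarize q A, binarize q B)"
    unfolding colorable_pair_iff[OF assms(1) binarize_pair[OF AB(1)]] num_leaves_binarize[OF nary(1)]
      q_def[symmetric] by blast
  then show "Y \<in> colorable_subgroup p"
    using binarize_pair[OF AB(1)] unfolding X(2) AB(2) phi_pair_class[OF AB(1)] colorable_subgroup_def
    by blast
next
  have q: "0 < q" using assms(1) by (simp add: q_def)
  fix Y assume "Y \<in> colorable_subgroup p"
  then obtain A B where AB: "(A, B) \<in> tree_pairs 2" "colorable_pair p (A, B)" "Y = pair_class 2 (A, B)"
    unfolding colorable_subgroup_def by auto
  obtain K where K: "\<forall>k\<ge>K. \<exists>B'. expands 2 (A, B) (full 2 k, B')"
    using expands_to_full[OF AB(1)] by blast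
  \<comment> \<open>The depth must be at least \<open>K\<close> for the expansion to exist and a multiple of \<open>q\<close> to lift.\<close>
  have "K \<le> q * K" using q by simp
  with K obtain B' where exp: "expands 2 (A, B) (complete_tree (q * K), B')"
    unfolding complete_tree_eq_full by blast
  have A': "\<forall>d\<in>set (depths (complete_tree (q * K))). q dvd d" by simp
  have "\<forall>i<num_leaves A. [depths A ! i = depths B ! i] (mod q)"
    using colorable_pair_iff[OF assms(1) AB(1)] AB(2) unfolding q_def by simp
  then have B': "\<forall>d\<in>set (depths B'). q dvd d"
    using A' by (rule expands_depths_dvd[OF exp])
  have pair: "(complete_tree (q * K), B') \<in> tree_pairs 2" by (rule expands_target[OF exp])
  obtain C where C: "nary (2 ^ q) C" "binarize q C = complete_tree (q * K)"
    by (rule binarize_surj[OF q nary_complete_tree A'])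
  have "nary 2 B'" using pair unfolding tree_pairs_iff by blast
  then obtain D where D: "nary (2 ^ q) D" "binarize q D = B'"
    by (rule binarize_surj[OF q _ B'])
  have "num_leaves C = num_leaves D"
    using pair num_leaves_binarize[OF C(1)] num_leaves_binarize[OF D(1)]
    unfolding C(2) D(2) tree_pairs_iff by argo
  then have CD: "(C, D) \<in> tree_pairs (2 ^ q)"
    using C(1) D(1) unfolding tree_pairs_iff by blast
  have "Y = phi q (pair_class (2 ^ q) (C, D))"
    unfolding AB(3) phi_pair_class[OF CD] C(2) D(2) by (rule pair_class_expands[OF exp])
  then show "Y \<in> phi q ` carrier (brown_thompson (2 ^ q))"
    using CD unfolding carrier_brown_thompson by blast
qed

lemma ord_eq_Least:
  fixes n a :: nat
  assumes "coprime n a"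
  shows "ord n a = (LEAST k. 0 < k \<and> [a ^ k = 1] (mod n))"
proof (rule Least_equality[symmetric])
  show "0 < ord n a \<and> [a ^ ord n a = 1] (mod n)"
    using assms ord_works[of a n] by simp
  show "ord n a \<le> k" if "0 < k \<and> [a ^ k = 1] (mod n)" for k
    using that ord_minimal[of k n a] by (meson not_le)
qed

theorem theorem4p4:
  fixes p q :: nat
  assumes "p \<ge> 3" and "odd p"
    and "q = (LEAST k. 0 < k \<and> [2 ^ k = 1] (mod p))"
  shows "group (brown_thompson (2 ^ q))
    \<and> group thompson_F
    \<and> subgroup (colorable_subgroup p) thompson_F
    \<and> thompson_F\<lparr>carrier := colorable_subgroup p\<rparr> \<cong> brown_thompson (2 ^ q)
    \<and> phi q \<in> iso (brown_thompson (2 ^ q)) (thompson_F\<lparr>carrier := colorable_subgroup p\<rparr>)"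
proof -
  have q: "q = ord p 2"
    using assms(2,3) ord_eq_Least[of p 2] by simp
  then have q_pos: "0 < q" using assms(2) by simp
  interpret group_hom "brown_thompson (2 ^ q)" thompson_F "phi q" by (rule group_hom_phi)
  have image: "phi q ` carrier (brown_thompson (2 ^ q)) = colorable_subgroup p"
    unfolding q by (rule phi_image[OF assms(2)])
  have sub: "subgroup (colorable_subgroup p) thompson_F"
    using img_is_subgroup unfolding image .
  have "phi q \<in> hom (brown_thompson (2 ^ q)) (thompson_F\<lparr>carrier := colorable_subgroup p\<rparr>)"
  proof (rule homI)
    show "phi q X \<in> carrier (thompson_F\<lparr>carrier := colorable_subgroup p\<rparr>)"
      if "X \<in> carrier (brown_thompson (2 ^ q))" for X
      using that image by auto
    show "phi q (X \<otimes>\<^bsub>brown_thompson (2 ^ q)\<^esub> Y) =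
        phi q X \<otimes>\<^bsub>thompson_F\<lparr>carrier := colorable_subgroup p\<rparr>\<^esub> phi q Y"
      if "X \<in> carrier (brown_thompson (2 ^ q))" "Y \<in> carrier (brown_thompson (2 ^ q))" for X Y
      using that by simp
  qed
  moreover have "bij_betw (phi q) (carrier (brown_thompson (2 ^ q)))
      (carrier (thompson_F\<lparr>carrier := colorable_subgroup p\<rparr>))"
    using inj_on_phi[OF q_pos] image by (simp add: bij_betw_def)
  ultimately have iso: "phi q \<in> iso (brown_thompson (2 ^ q)) (thompson_F\<lparr>carrier := colorable_subgroup p\<rparr>)"
    by (rule isoI)
  show ?thesis
    by (intro conjI group_brown_thompson sub iso group.iso_sym[OF group_brown_thompson is_isoI[OF iso]])
qed

end
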